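(* Let $n\in\mathbb N$ be such that $n=2^{\ell(n)}+k$, where $\ell(n)\ge1$ is an integer and $1\le k\le 2^{\ell(n)-1}$. Let $I\subseteq\{1,2\}^{\ell(n)-1}$ with $\mathrm{card}(I)=k=n-2^{\ell(n)}$. Then, for each admissible choice of the sets $A_\sigma$, the set $\alpha_n=\alpha_n(I)$ given by $$\alpha_n(I)=\begin{cases}\bigcup_{\sigma\in I}A_\sigma\cup\left\{S_{\sigma1}(\tfrac12),S_{\sigma2}(\tfrac12):\sigma\in\{1,2\}^{\ell(n)-1}\setminus I\right\}&\text{if }1\le k<2^{\ell(n)-1},\\ \bigcup_{\sigma\in I}A_\sigma&\text{if }k=2^{\ell(n)-1}\ne1,\\ A_\emptyset&\text{if }k=2^{\ell(n)-1}=1,\text{ i.e. when }n=3,\end{cases}$$ forms a CVT with $n$-means for $P$. The number of such CVTs (over all choices of $I$ and of the $A_\sigma$) is $2^{n-2^{\ell(n)}}\binom{2^{\ell(n)-1}}{n-2^{\ell(n)}}$ if $1\le k<2^{\ell(n)-1}$, and it is $2^{2^{\ell(n)-1}}$ if $k=2^{\ell(n)-1}$.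
   Context: Let $S_1(x)=\frac49x$ and $S_2(x)=\frac49x+\frac59$ on $\mathbb R$, and let $P$ be the unique Borel probability measure on $\mathbb R$ with $P=\frac12P\circ S_1^{-1}+\frac12P\circ S_2^{-1}$. For a word $\sigma=\sigma_1\cdots\sigma_k\in\{1,2\}^k$ put $S_\sigma=S_{\sigma_1}\circ\cdots\circ S_{\sigma_k}$ and $J_\sigma=S_\sigma([0,1])$; $\emptyset$ is the empty word ($S_\emptyset=\mathrm{id}$, $\{1,2\}^0=\{\emptyset\}$), and $\sigma\tau$ denotes concatenation. For words $\beta,\gamma,\dots,\delta$, $$a(\beta,\gamma,\dots,\delta)=\frac{1}{P(J_\beta\cup J_\gamma\cup\cdots\cup J_\delta)}\int_{J_\beta\cup J_\gamma\cup\cdots\cup J_\delta}x\,dP(x).$$ For each word $\sigma$, $A_\sigma$ denotes one of the following two sets (chosen arbitrarily and independently for each $\sigma$): $\{a(\sigma11,\sigma121,\sigma1221),\ a(\sigma1222,\sigma21),\ a(\sigma22)\}$ or $\{a(\sigma11),\ a(\sigma12,\sigma2111),\ a(\sigma2112,\sigma212,\sigma22)\}$. For a finite set $\alpha\subset\mathbb R$, the Voronoi region of $a\in\alpha$ is $M(a|\alpha)=\{x\in\mathbb R:|x-a|=\min_{b\in\alpha}|x-b|\}$. A set $\alpha$ of $n$ points forms a centroidal Voronoi tessellation (CVT) with $n$-means (for $P$) if for every $a\in\alpha$ we have $P(M(a|\alpha))>0$ and $a=\frac{1}{P(M(a|\alpha))}\int_{M(a|\alpha)}x\,dP(x)$.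 *)

theory Defs
  imports "HOL-Analysis.Analysis" "HOL-Probability.Probability_Measure"
begin

definition similitude :: "nat \<Rightarrow> real \<Rightarrow> real" where
  "similitude i x = (if i = 1 then 4 / 9 * x else 4 / 9 * x + 5 / 9)"

text \<open>Words over the alphabet \<open>{1, 2}\<close> are lists of natural numbers; concatenation is \<open>@\<close>.
  The values of \<open>similitude\<close> at indices other than 1 and 2 are irrelevant.\<close>

definition words :: "nat \<Rightarrow> nat list set" where
  "words k = {\<sigma>. length \<sigma> = k \<and> set \<sigma> \<subseteq> {1, 2}}"

primrec word_map :: "nat list \<Rightarrow> real \<Rightarrow> real" where
  "word_map [] = id"
| "word_map (i # \<sigma>) = similitude i \<circ> word_map \<sigma>"

definition J :: "nat list \<Rightarrow> real set" where
  "J \<sigma> = word_map \<sigma> ` {0..1}"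

definition self_similar :: "real measure \<Rightarrow> bool" where
  "self_similar P \<longleftrightarrow> prob_space P \<and> sets P = sets borel \<and>
     (\<forall>B\<in>sets borel. measure P B =
        1 / 2 * measure P (similitude 1 -` B) + 1 / 2 * measure P (similitude 2 -` B))"

text \<open>The centroid \<open>a(\<beta>, \<gamma>, \<dots>, \<delta>)\<close>, the words being given as a list.\<close>

definition centroid :: "real measure \<Rightarrow> nat list list \<Rightarrow> real" where
  "centroid P ws =
     1 / measure P (\<Union>\<beta>\<in>set ws. J \<beta>) * (LINT x:(\<Union>\<beta>\<in>set ws. J \<beta>)|P. x)"

definition triple1 :: "real measure \<Rightarrow> nat list \<Rightarrow> real set" where
  "triple1 P \<sigma> =
     {centroid P [\<sigma> @ [1,1], \<sigma> @ [1,2,1], \<sigma> @ [1,2,2,1]],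
      centroid P [\<sigma> @ [1,2,2,2], \<sigma> @ [2,1]],
      centroid P [\<sigma> @ [2,2]]}"

definition triple2 :: "real measure \<Rightarrow> nat list \<Rightarrow> real set" where
  "triple2 P \<sigma> =
     {centroid P [\<sigma> @ [1,1]],
      centroid P [\<sigma> @ [1,2], \<sigma> @ [2,1,1,1]],
      centroid P [\<sigma> @ [2,1,1,2], \<sigma> @ [2,1,2], \<sigma> @ [2,2]]}"

text \<open>A family \<open>\<sigma> \<mapsto> A\<^sub>\<sigma>\<close> is admissible if each \<open>A\<^sub>\<sigma>\<close> is one of the two triples, chosen
  independently for each word.\<close>

definition admissible :: "real measure \<Rightarrow> (nat list \<Rightarrow> real set) \<Rightarrow> bool" where
  "admissible P A \<longleftrightarrow> (\<forall>m. \<forall>\<sigma>\<in>words m. A \<sigma> = triple1 P \<sigma> \<or> A \<sigma> = triple2 P \<sigma>)"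

text \<open>The set \<open>\<alpha>\<^sub>n(I)\<close> for \<open>n = 2 ^ l + k\<close> and the family \<open>A\<close>; it is used only for
  \<open>1 \<le> l\<close> and \<open>1 \<le> k \<le> 2 ^ (l - 1)\<close>.\<close>

definition alpha :: "nat \<Rightarrow> nat \<Rightarrow> nat list set \<Rightarrow> (nat list \<Rightarrow> real set) \<Rightarrow> real set" where
  "alpha l k I A =
     (if k < 2 ^ (l - 1) then
        (\<Union>\<sigma>\<in>I. A \<sigma>) \<union>
        (\<Union>\<sigma>\<in>words (l - 1) - I. {word_map (\<sigma> @ [1]) (1 / 2), word_map (\<sigma> @ [2]) (1 / 2)})
      else if k \<noteq> 1 then (\<Union>\<sigma>\<in>I. A \<sigma>)
      else A [])"

definition voronoi :: "real \<Rightarrow> real set \<Rightarrow> real set" where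
  "voronoi a \<alpha> = {x. \<bar>x - a\<bar> = Min ((\<lambda>b. \<bar>x - b\<bar>) ` \<alpha>)}"

definition CVT :: "real measure \<Rightarrow> nat \<Rightarrow> real set \<Rightarrow> bool" where
  "CVT P n \<alpha> \<longleftrightarrow> finite \<alpha> \<and> card \<alpha> = n \<and>
     (\<forall>a\<in>\<alpha>. measure P (voronoi a \<alpha>) > 0 \<and>
        a = 1 / measure P (voronoi a \<alpha>) * (LINT x:voronoi a \<alpha>|P. x))"

end

theory Submission
  imports Defs
begin

text \<open>The set \<open>alpha l k I A\<close> is built block by block: the blocks are the cylinders \<open>J \<sigma>\<close> with
\<open>|\<sigma>| = l - 1\<close>, and each block is cut into two or three cells, which are unions of cylinders, with the
centroids of the cells as centres. To see that the centres form a CVT it is enough that every point of a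
cell is strictly nearer to the centroid of its cell than to any other centre, because then
the Voronoi regions agree with the cells up to a null set (\<open>CVT_of_nearest_regions\<close>).

Within one block this is a computation for the empty word, since \<open>P\<close> restricted to \<open>J \<sigma>\<close> is an affine
copy of \<open>P\<close> and centroids are carried along (\<open>centroid_append\<close>). There are three possible tilings of the
unit interval, with eight different cells; their centroids are explicit rationals (\<open>centroid_values\<close>), and
each midpoint between neighbouring centroids falls into a gap between the cells (\<open>tiling_nearest\<close>).
Between different blocks a rough estimate suffices: the gap between two blocks is at least a quarter of their
length (\<open>word_map_separated\<close>), more than enough to make up for the way in which the tilings
of the two blocks differ (\<open>blocks_nearest\<close>). So the tilings of the blocks can be chosen independently.

For the count, the set of centres remembers the tiling of every block, because the three tilings have
different sets of centroids (\<open>centre_set_determines_layout\<close>). Hence the CVTs correspond to the pairs consisting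
of a \<open>k\<close>-element set \<open>I\<close> of the \<open>2^(l-1)\<close> words and a subset of \<open>I\<close>; for \<open>k = 2^(l-1)\<close> there is only one such \<open>I\<close>.\<close>

section \<open>Words and cylinders\<close>

lemma borel_measurable_similitude [measurable]: "similitude i \<in> borel_measurable borel"
proof -
  have "similitude i = (\<lambda>x. if i = 1 then 4 / 9 * x else 4 / 9 * x + 5 / 9)"
    by (simp add: similitude_def fun_eq_iff)
  then show ?thesis
    by (simp only:) measurable
qed

text \<open>Everything below is computed in the coordinate \<open>x \<in> [0,1]\<close> of a cylinder \<open>J \<sigma>\<close> and carried over by
this affine formula. Every letter other than 1 acts as the second map, so the formula, and with it
the lemmas on the mass and the mean of a cylinder, hold for all lists of natural numbers.\<close>

lemma word_map_affine: "word_map \<sigma> x = word_map \<sigma> 0 + (4 / 9) ^ length \<sigma> * x"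
  by (induction \<sigma>) (auto simp: similitude_def algebra_simps)

lemma word_map_append: "word_map (\<sigma> @ \<tau>) x = word_map \<sigma> (word_map \<tau> x)"
  by (induction \<sigma>) auto

lemma similitude_eq_iff [simp]: "similitude i x = similitude i y \<longleftrightarrow> x = y"
  by (auto simp: similitude_def)

lemma inj_word_map: "inj (word_map \<sigma>)"
  by (rule injI, subst (asm) (1 2) word_map_affine) simp

lemma J_eq: "J \<sigma> = {word_map \<sigma> 0 .. word_map \<sigma> 0 + (4 / 9) ^ length \<sigma>}"
proof -
  have "J \<sigma> = (\<lambda>x. (4 / 9) ^ length \<sigma> * x + word_map \<sigma> 0) ` {0..1}"
    unfolding J_def by (rule image_cong[OF refl], subst word_map_affine) simp
  then show ?thesis
    by (simp only: image_affinity_atLeastAtMost) (auto simp: add.commute)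
qed

lemma J_append: "J (\<sigma> @ \<tau>) = word_map \<sigma> ` J \<tau>"
  by (auto simp: J_def word_map_append)

lemma word_map_bounds: "0 \<le> word_map \<sigma> 0" "word_map \<sigma> 0 + (4 / 9) ^ length \<sigma> \<le> 1"
  by (induction \<sigma>) (auto simp: similitude_def)

lemma J_subset_unit: "J \<sigma> \<subseteq> {0..1}"
  using word_map_bounds[of \<sigma>] unfolding J_eq by auto

lemma word_map_image_unit: "B \<subseteq> {0..1} \<Longrightarrow> word_map \<sigma> ` B \<subseteq> {0..1}"
  using J_subset_unit[of \<sigma>] unfolding J_def by blast

lemma word_map_measurable_image:
  assumes [measurable]: "B \<in> sets borel"
  shows "word_map \<sigma> ` B \<in> sets borel"
proof -
  have "word_map \<sigma> ` B = (\<lambda>y. (y - word_map \<sigma> 0) / (4 / 9) ^ length \<sigma>) -` B \<inter> space borel"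
  proof (intro set_eqI iffI)
    fix y assume "y \<in> word_map \<sigma> ` B"
    then obtain x where x: "x \<in> B" "y = word_map \<sigma> x" by blast
    then show "y \<in> (\<lambda>y. (y - word_map \<sigma> 0) / (4 / 9) ^ length \<sigma>) -` B \<inter> space borel"
      by (subst (asm) word_map_affine) simp
  next
    fix y assume y: "y \<in> (\<lambda>y. (y - word_map \<sigma> 0) / (4 / 9) ^ length \<sigma>) -` B \<inter> space borel"
    have "y = word_map \<sigma> ((y - word_map \<sigma> 0) / (4 / 9) ^ length \<sigma>)"
      by (simp add: word_map_affine[of \<sigma> "(y - word_map \<sigma> 0) / (4 / 9) ^ length \<sigma>"])
    with y show "y \<in> word_map \<sigma> ` B" by blast
  qed
  also have "\<dots> \<in> sets borel" by measurable
  finally show ?thesis .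
qed

lemma J_borel [measurable]: "J \<sigma> \<in> sets borel"
  unfolding J_eq by simp

lemma finite_words: "finite (words m)"
  unfolding words_def using finite_lists_length_eq[of "{1, 2 :: nat}" m]
  by (simp add: conj_commute)

lemma card_words: "card (words m) = 2 ^ m"
  unfolding words_def using card_lists_length_eq[of "{1, 2 :: nat}" m]
  by (simp add: conj_commute numeral_2_eq_2)

definition region :: "nat list list \<Rightarrow> real set" where
  "region ws = (\<Union>\<beta>\<in>set ws. J \<beta>)"

lemma region_borel [measurable]: "region ws \<in> sets borel"
  unfolding region_def by (intro sets.finite_UN) auto

lemma region_subset_unit: "region ws \<subseteq> {0..1}"
  unfolding region_def using J_subset_unit by blast

lemma region_append: "region (map ((@) \<sigma>) ws) = word_map \<sigma> ` region ws"
  unfolding region_def by (auto simp: J_append)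

text \<open>Two cylinders of the same generation \<open>m\<close> are not merely disjoint: relative to their length
\<open>(4/9)^m\<close>, the gap between them is at least \<open>1/4\<close>. Indeed, at the first letter where the words differ
they are separated by a gap of \<open>1/9\<close> of their last common ancestor, and their own length is at most
\<open>4/9\<close> of it.\<close>

lemma word_map_separated:
  assumes "\<sigma> \<in> words m" "\<tau> \<in> words m" "\<sigma> \<noteq> \<tau>"
  shows "word_map \<sigma> 0 + 5 / 4 * (4 / 9) ^ m \<le> word_map \<tau> 0
       \<or> word_map \<tau> 0 + 5 / 4 * (4 / 9) ^ m \<le> word_map \<sigma> 0"
  using assms
proof (induction m arbitrary: \<sigma> \<tau>)
  case (Suc m)
  then obtain i \<rho> j \<upsilon> where [simp]: "\<sigma> = i # \<rho>" "\<tau> = j # \<upsilon>"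
    by (auto simp: words_def length_Suc_conv)
  have ij: "i \<in> {1, 2}" "j \<in> {1, 2}" and words: "\<rho> \<in> words m" "\<upsilon> \<in> words m"
    using Suc.prems by (auto simp: words_def)
  then have len: "length \<rho> = m" "length \<upsilon> = m" by (auto simp: words_def)
  show ?case
  proof (cases "i = j")
    case True
    with Suc.prems Suc.IH[OF words] show ?thesis by (auto simp: similitude_def)
  next
    case False
    have "(4 / 9 :: real) ^ m \<le> 1" by (simp add: power_le_one)
    with False ij word_map_bounds[of \<rho>] word_map_bounds[of \<upsilon>] show ?thesis
      by (auto simp: similitude_def len)
  qed
qed (auto simp: words_def)

lemma same_length_J_disjoint:
  assumes "\<sigma> \<in> words m" "\<tau> \<in> words m" "x \<in> {0..1}" "y \<in> {0..1}" "word_map \<sigma> x = word_map \<tau> y"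
  shows "\<sigma> = \<tau>"
proof (rule ccontr)
  assume "\<sigma> \<noteq> \<tau>"
  have len: "length \<sigma> = m" "length \<tau> = m" using assms by (auto simp: words_def)
  have "0 < (4 / 9 :: real) ^ m" by simp
  moreover have "(4 / 9) ^ m * x \<le> (4 / 9 :: real) ^ m" "(4 / 9) ^ m * y \<le> (4 / 9 :: real) ^ m"
      "0 \<le> (4 / 9 :: real) ^ m * x" "0 \<le> (4 / 9 :: real) ^ m * y"
    using assms(3,4) by (auto simp: mult_left_le)
  ultimately show False
    using word_map_separated[OF assms(1,2) \<open>\<sigma> \<noteq> \<tau>\<close>] assms(5)
      word_map_affine[of \<sigma> x] word_map_affine[of \<tau> y] unfolding len by linarith
qed

lemma region_Nil [simp]: "region [] = {}"
  by (simp add: region_def)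

lemma region_Cons [simp]: "region (\<beta> # ws) = J \<beta> \<union> region ws"
  by (simp add: region_def)

section \<open>Self-similar measures\<close>

lemma continuous_bounded_on_unit:
  fixes g :: "real \<Rightarrow> real"
  assumes "continuous_on UNIV g"
  obtains K where "\<And>x. x \<in> {0..1} \<Longrightarrow> \<bar>g x\<bar> \<le> K"
proof -
  have "compact (g ` {0..1})"
    using assms continuous_on_subset by (intro compact_continuous_image) auto
  then show ?thesis
    using that compact_imp_bounded[of "g ` {0..1}"] unfolding bounded_iff by fastforce
qed

locale cantor_measure =
  fixes P :: "real measure"
  assumes self_similar: "self_similar P"
begin

sublocale prob_space P
  using self_similar by (simp add: self_similar_def)

lemma sets_P [simp, measurable_cong]: "sets P = sets borel"
  using self_similar by (simp add: self_similar_def)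

lemma space_P [simp]: "space P = UNIV"
  using sets_eq_imp_space_eq[OF sets_P] by simp

lemma measurable_P [simp]: "borel_measurable P = borel_measurable borel"
  by (rule measurable_cong_sets) auto

lemma measure_step:
  assumes "B \<in> sets borel"
  shows "measure P B = 1 / 2 * measure P (similitude 1 -` B) + 1 / 2 * measure P (similitude 2 -` B)"
  using self_similar assms by (simp add: self_similar_def)

lemma emeasure_step:
  assumes "B \<in> sets borel"
  shows "emeasure P B = ennreal (1 / 2) * emeasure P (similitude 1 -` B)
                      + ennreal (1 / 2) * emeasure P (similitude 2 -` B)"
proof -
  have "ennreal (1 / 2 * p) = ennreal (1 / 2) * ennreal p" if "p \<ge> 0" for p
    using that by (intro ennreal_mult) auto
  then show ?thesis
    unfolding emeasure_eq_measure measure_step[OF assms]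
    by (subst ennreal_plus) (simp_all only: measure_nonneg mult_nonneg_nonneg
        zero_le_divide_1_iff zero_le_numeral)
qed

text \<open>Self-similarity is given on sets only; it passes to integrals by the usual induction over
nonnegative measurable functions.\<close>

lemma nn_integral_step:
  assumes "f \<in> borel_measurable borel"
  shows "(\<integral>\<^sup>+x. f x \<partial>P) = ennreal (1 / 2) * (\<integral>\<^sup>+x. f (similitude 1 x) \<partial>P)
                           + ennreal (1 / 2) * (\<integral>\<^sup>+x. f (similitude 2 x) \<partial>P)"
  using assms
proof (induction rule: borel_measurable_induct)
  case (cong f g)
  then show ?case by simp
next
  case (set B)
  have "(\<integral>\<^sup>+x. indicator B (similitude i x) \<partial>P) = emeasure P (similitude i -` B)" for i
  proof -
    have [measurable]: "B \<in> sets borel" by fact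
    have "similitude i -` B \<in> sets borel"
      using measurable_sets[OF borel_measurable_similitude, of B i] set by simp
    moreover have "(\<lambda>x. indicator B (similitude i x) :: ennreal) = indicator (similitude i -` B)"
      by (auto simp: indicator_def)
    ultimately show ?thesis by simp
  qed
  then show ?case using emeasure_step set by simp
next
  case (mult u c)
  have [measurable]: "u \<in> borel_measurable borel" by fact
  show ?case using mult(4) by (simp add: nn_integral_cmult distrib_left mult.left_commute)
next
  case (add u v)
  have [measurable]: "u \<in> borel_measurable borel" "v \<in> borel_measurable borel" by fact+
  show ?case using add by (simp add: nn_integral_add distrib_left ac_simps)
next
  case (seq U)
  have [measurable]: "U i \<in> borel_measurable borel" for i by fact
  have inc: "incseq (\<lambda>n x. U n (h x))" for h :: "real \<Rightarrow> real"
    using seq(3) by (auto simp: incseq_def le_fun_def)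
  have lim: "(\<integral>\<^sup>+x. (SUP i. U i) (h x) \<partial>P) = (SUP i. \<integral>\<^sup>+x. U i (h x) \<partial>P)"
    if [measurable]: "h \<in> borel_measurable borel" for h
    using nn_integral_monotone_convergence_SUP[OF inc, of h P] by (simp add: image_comp)
  have mono: "incseq (\<lambda>i. c * (\<integral>\<^sup>+x. U i (h x) \<partial>P))" for h and c :: ennreal
    using inc[of h] by (auto simp: incseq_def le_fun_def intro!: mult_left_mono nn_integral_mono)
  have "(\<integral>\<^sup>+x. (SUP i. U i) x \<partial>P) = (SUP i. \<integral>\<^sup>+x. U i x \<partial>P)"
    by (rule lim) measurable
  also have "\<dots> = (SUP i. ennreal (1 / 2) * (\<integral>\<^sup>+x. U i (similitude 1 x) \<partial>P)
                        + ennreal (1 / 2) * (\<integral>\<^sup>+x. U i (similitude 2 x) \<partial>P))"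
    by (simp only: seq.IH)
  also have "\<dots> = ennreal (1 / 2) * (SUP i. \<integral>\<^sup>+x. U i (similitude 1 x) \<partial>P)
                  + ennreal (1 / 2) * (SUP i. \<integral>\<^sup>+x. U i (similitude 2 x) \<partial>P)"
    by (simp only: ennreal_SUP_add[OF mono mono] SUP_mult_left_ennreal)
  finally show ?case
    by (simp only: lim[OF borel_measurable_similitude])
qed

lemma integrable_boundedI:
  fixes f :: "real \<Rightarrow> real"
  assumes "f \<in> borel_measurable borel" "\<And>x. \<bar>f x\<bar> \<le> C"
  shows "integrable P f"
  by (rule integrable_const_bound[where B = C]) (use assms in auto)

lemma integral_step:
  fixes f :: "real \<Rightarrow> real"
  assumes [measurable]: "f \<in> borel_measurable borel" and bound: "\<And>x. \<bar>f x\<bar> \<le> C"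
  shows "(LINT x|P. f x) = 1 / 2 * (LINT x|P. f (similitude 1 x)) + 1 / 2 * (LINT x|P. f (similitude 2 x))"
proof -
  have fin: "(\<integral>\<^sup>+x. ennreal (h x) \<partial>P) < \<infinity>" if "\<And>x. h x \<le> C" for h
  proof -
    have "(\<integral>\<^sup>+x. ennreal (h x) \<partial>P) \<le> (\<integral>\<^sup>+x. ennreal C \<partial>P)"
      by (rule nn_integral_mono) (use that in \<open>auto intro: ennreal_leI\<close>)
    also have "\<dots> < \<infinity>" by (simp add: emeasure_eq_measure ennreal_mult_less_top)
    finally show ?thesis .
  qed
  have split: "enn2real (\<integral>\<^sup>+x. ennreal (h x) \<partial>P)
      = 1 / 2 * enn2real (\<integral>\<^sup>+x. ennreal (h (similitude 1 x)) \<partial>P)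
      + 1 / 2 * enn2real (\<integral>\<^sup>+x. ennreal (h (similitude 2 x)) \<partial>P)"
    if [measurable]: "h \<in> borel_measurable borel" and "\<And>x. h x \<le> C" for h
    using nn_integral_step[of "\<lambda>x. ennreal (h x)"] fin[of "\<lambda>x. h (similitude 1 x)"]
      fin[of "\<lambda>x. h (similitude 2 x)"] that
    by (simp add: enn2real_plus enn2real_mult ennreal_mult_less_top del: ennreal_half)
  have int: "integrable P f" "integrable P (\<lambda>x. f (similitude i x))" for i
    by (rule integrable_boundedI[where C = C]; use bound in measurable)+
  have "f x \<le> C" "- f x \<le> C" for x using bound[of x] by auto
  then show ?thesis
    unfolding int[THEN real_lebesgue_integral_def]
    using split[of f] split[of "\<lambda>x. - f x"] by (simp add: algebra_simps)
qed

text \<open>Write \<open>f t\<close> for the mass of \<open>[-t, 1 + t]\<close>. Both preimages of this interval contain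
\<open>[-9t/4, 1 + 9t/4]\<close>, so \<open>f t \<ge> f (9t/4)\<close>. Iterating, the intervals exhaust the line and \<open>f t = 1\<close> for
every \<open>t > 0\<close>; then let \<open>t\<close> tend to \<open>0\<close>.\<close>

lemma AE_unit: "AE x in P. x \<in> {0..1}"
proof -
  define f where "f t = measure P {- t..1 + t}" for t
  have grow: "f (9 / 4 * t) \<le> f t" if "t \<ge> 0" for t
  proof -
    have m: "similitude i -` {- t..1 + t} \<in> sets borel" for i
      using measurable_sets[OF borel_measurable_similitude, of "{- t..1 + t}" i] by simp
    have "{- (9 / 4 * t)..1 + 9 / 4 * t} \<subseteq> similitude i -` {- t..1 + t}" for i
      using that by (auto simp: similitude_def)
    then have "f (9 / 4 * t) \<le> measure P (similitude i -` {- t..1 + t})" for i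
      unfolding f_def using m by (intro finite_measure_mono) auto
    from this[of 1] this[of 2] measure_step[of "{- t..1 + t}"] show ?thesis
      unfolding f_def by auto
  qed
  have iter: "f ((9 / 4) ^ n * t) \<le> f t" if "t \<ge> 0" for n t
  proof (induction n)
    case (Suc n)
    have "f ((9 / 4) ^ Suc n * t) \<le> f ((9 / 4) ^ n * t)"
      using grow[of "(9 / 4) ^ n * t"] that by (simp add: mult.assoc)
    with Suc show ?case by simp
  qed simp
  have one: "f t = 1" if "t > 0" for t
  proof -
    have "(\<lambda>n. f ((9 / 4) ^ n * t)) \<longlonglongrightarrow> measure P (\<Union>n. {- ((9 / 4) ^ n * t)..1 + (9 / 4) ^ n * t})"
      unfolding f_def
    proof (rule finite_Lim_measure_incseq)
      show "incseq (\<lambda>n. {- ((9 / 4) ^ n * t)..1 + (9 / 4) ^ n * t})"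
      proof (rule incseq_SucI)
        fix n
        have "(9 / 4) ^ n * t \<le> (9 / 4) ^ Suc n * t" using that by simp
        then show "{- ((9 / 4) ^ n * t)..1 + (9 / 4) ^ n * t}
            \<subseteq> {- ((9 / 4) ^ Suc n * t)..1 + (9 / 4) ^ Suc n * t}" by auto
      qed
    qed auto
    also have "(\<Union>n. {- ((9 / 4) ^ n * t)..1 + (9 / 4) ^ n * t}) = UNIV"
    proof -
      have "\<exists>n. x \<in> {- ((9 / 4) ^ n * t)..1 + (9 / 4) ^ n * t}" for x
      proof -
        obtain n where "\<bar>x\<bar> / t < (9 / 4) ^ n" using real_arch_pow[of "9 / 4" "\<bar>x\<bar> / t"] by auto
        then have "\<bar>x\<bar> < (9 / 4) ^ n * t" using that by (simp add: field_simps)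
        then show ?thesis by (intro exI[of _ n]) auto
      qed
      then show ?thesis by blast
    qed
    finally have "(\<lambda>n. f ((9 / 4) ^ n * t)) \<longlonglongrightarrow> 1" using prob_space by simp
    then have "1 \<le> f t" by (rule LIMSEQ_le_const2) (use iter that in auto)
    then show ?thesis unfolding f_def using prob_le_1 by (simp add: antisym)
  qed
  have "AE x in P. \<forall>n. x \<in> {- (1 / real (Suc n))..1 + 1 / real (Suc n)}"
    unfolding AE_all_countable using one by (intro allI AE_prob_1) (simp add: f_def)
  then show ?thesis
  proof (rule AE_mp, intro AE_I2 impI)
    fix x :: real assume x: "\<forall>n. x \<in> {- (1 / real (Suc n))..1 + 1 / real (Suc n)}"
    have "(\<lambda>n. 1 / real (Suc n)) \<longlonglongrightarrow> 0" by real_asymp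
    then have "0 \<le> x" "x \<le> 1"
      using LIMSEQ_le_const2[of "\<lambda>n. - (1 / real (Suc n))" 0 x] x
        LIMSEQ_le_const[of "\<lambda>n. 1 + 1 / real (Suc n)" 1 x]
        tendsto_minus[of "\<lambda>n. 1 / real (Suc n)" 0 sequentially]
        tendsto_add[OF tendsto_const[of 1], of "\<lambda>n. 1 / real (Suc n)" 0 sequentially] by auto
    then show "x \<in> {0..1}" by simp
  qed
qed

text \<open>Restricted to a cylinder, \<open>P\<close> is a scaled copy of itself. One letter is peeled off at a time: in the
self-similarity equation for an integrand supported in \<open>J (i # \<sigma>)\<close>, the term of the other map
vanishes because that map sends \<open>[0,1]\<close>, which carries \<open>P\<close>, to the other half.\<close>

lemma integral_cylinder:
  fixes g :: "real \<Rightarrow> real"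
  assumes "B \<subseteq> {0..1}" "B \<in> sets borel" "continuous_on UNIV g"
  shows "(LINT x:word_map \<sigma> ` B|P. g x) = (1 / 2) ^ length \<sigma> * (LINT x:B|P. g (word_map \<sigma> x))"
  using assms(3)
proof (induction \<sigma> arbitrary: g)
  case (Cons i \<sigma>)
  define C where "C = word_map \<sigma> ` B"
  define j where "j = (if i = 1 then 2 else 1 :: nat)"
  have C: "C \<subseteq> {0..1}" and [measurable]: "C \<in> sets borel"
    unfolding C_def using assms by (auto simp: word_map_image_unit word_map_measurable_image)
  have img: "word_map (i # \<sigma>) ` B = similitude i ` C" "similitude i ` C = word_map [i] ` C"
    unfolding C_def by auto
  have [measurable]: "similitude i ` C \<in> sets borel"
    unfolding img(2) by (rule word_map_measurable_image) measurable
  have C01: "similitude i ` C \<subseteq> {0..1}" unfolding img(2) by (rule word_map_image_unit[OF C])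
  have [measurable]: "g \<in> borel_measurable borel"
    using Cons.prems by (rule borel_measurable_continuous_onI)
  obtain K where K: "\<And>x. x \<in> {0..1} \<Longrightarrow> \<bar>g x\<bar> \<le> K"
    using continuous_bounded_on_unit[OF Cons.prems] by blast
  define f where "f x = indicator (similitude i ` C) x * g x" for x
  have f_meas: "f \<in> borel_measurable borel" unfolding f_def by measurable
  have f_bound: "\<bar>f x\<bar> \<le> max K 0" for x
    using K[of x] C01 by (auto simp: f_def indicator_def)
  have same: "(LINT x|P. f (similitude i x)) = (LINT x:C|P. g (similitude i x))"
    unfolding set_lebesgue_integral_def f_def
    by (intro Bochner_Integration.integral_cong) (auto simp: indicator_def)
  have other: "(LINT x|P. f (similitude j x)) = 0"
  proof -
    have "AE x in P. f (similitude j x) = 0"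
      using AE_unit
    proof (rule AE_mp, intro AE_I2 impI)
      fix x :: real assume "x \<in> {0..1}"
      then have "similitude j x \<noteq> similitude i c" if "c \<in> {0..1}" for c
        using that by (cases "i = 1") (auto simp: j_def similitude_def)
      with C have "similitude j x \<noteq> similitude i c" if "c \<in> C" for c using that by blast
      then have "similitude j x \<notin> similitude i ` C" by blast
      then show "f (similitude j x) = 0" by (simp add: f_def)
    qed
    then show ?thesis by (rule integral_eq_zero_AE)
  qed
  have s2: "similitude i = similitude 2" if "i \<noteq> 1" using that by (auto simp: similitude_def fun_eq_iff)
  have "(LINT x:word_map (i # \<sigma>) ` B|P. g x) = (LINT x|P. f x)"
    unfolding img(1) f_def set_lebesgue_integral_def by simp
  also have "\<dots> = 1 / 2 * (LINT x|P. f (similitude i x)) + 1 / 2 * (LINT x|P. f (similitude j x))"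
    using integral_step[OF f_meas f_bound] s2 by (cases "i = 1") (auto simp: j_def)
  also have "\<dots> = 1 / 2 * (LINT x:C|P. g (similitude i x))"
    using same other by simp
  also have "\<dots> = 1 / 2 * ((1 / 2) ^ length \<sigma> * (LINT x:B|P. g (similitude i (word_map \<sigma> x))))"
  proof -
    have "continuous_on UNIV (\<lambda>x. g (similitude i x))"
      unfolding similitude_def
      by (cases "i = 1") (auto intro!: continuous_intros continuous_on_compose2[OF Cons.prems])
    from Cons.IH[OF this] show ?thesis unfolding C_def by simp
  qed
  finally show ?case by simp
qed simp

section \<open>Mass and mean of cylinders\<close>

lemma measure_unit: "measure P {0..1} = 1"
  using AE_unit by (subst prob_eq_1) auto

lemma measure_cylinder:
  assumes "B \<subseteq> {0..1}" "B \<in> sets borel"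
  shows "measure P (word_map \<sigma> ` B) = (1 / 2) ^ length \<sigma> * measure P B"
  using integral_cylinder[OF assms, of "\<lambda>x. 1" \<sigma>] assms(2) word_map_measurable_image[OF assms(2)]
  by (simp add: set_lebesgue_integral_def)

lemma measure_J: "measure P (J \<sigma>) = (1 / 2) ^ length \<sigma>"
  using measure_cylinder[of "{0..1}" \<sigma>] by (simp add: J_def measure_unit)

lemma set_integrable_bounded:
  assumes "B \<subseteq> {0..1}" "B \<in> sets borel" "continuous_on UNIV (g :: real \<Rightarrow> real)"
  shows "set_integrable P B g"
proof -
  have [measurable]: "g \<in> borel_measurable borel" "B \<in> sets borel"
    using assms borel_measurable_continuous_onI by auto
  obtain K where K: "\<And>x. x \<in> {0..1} \<Longrightarrow> \<bar>g x\<bar> \<le> K"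
    using continuous_bounded_on_unit[OF assms(3)] by blast
  show ?thesis unfolding set_integrable_def
  proof (rule integrable_boundedI[where C = "max K 0"])
    show "\<bar>indicator B x *\<^sub>R g x\<bar> \<le> max K 0" for x
      using K[of x] assms(1) by (auto simp: indicator_def)
  qed measurable
qed

lemma moment_cylinder:
  assumes "B \<subseteq> {0..1}" "B \<in> sets borel"
  shows "(LINT x:word_map \<sigma> ` B|P. x)
       = (1 / 2) ^ length \<sigma> * (word_map \<sigma> 0 * measure P B + (4 / 9) ^ length \<sigma> * (LINT x:B|P. x))"
proof -
  have "(LINT x:B|P. word_map \<sigma> x) = (LINT x:B|P. word_map \<sigma> 0 + (4 / 9) ^ length \<sigma> * x)"
    by (subst word_map_affine) simp
  also have "\<dots> = (LINT x:B|P. word_map \<sigma> 0) + (LINT x:B|P. (4 / 9) ^ length \<sigma> * x)"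
    by (rule set_integral_add) (auto intro!: set_integrable_bounded assms continuous_intros)
  also have "\<dots> = word_map \<sigma> 0 * measure P B + (4 / 9) ^ length \<sigma> * (LINT x:B|P. x)"
    using assms(2) by (simp add: set_lebesgue_integral_def)
  finally show ?thesis
    using integral_cylinder[OF assms, of "\<lambda>x. x" \<sigma>] by simp
qed

text \<open>Centroids commute with the similitudes, so the sets \<open>A \<sigma>\<close> need to be evaluated for the empty
word only.\<close>

lemma centroid_append:
  assumes "measure P (region ws) > 0"
  shows "centroid P (map ((@) \<sigma>) ws) = word_map \<sigma> (centroid P ws)"
proof -
  have "centroid P (map ((@) \<sigma>) ws)
      = 1 / measure P (word_map \<sigma> ` region ws) * (LINT x:word_map \<sigma> ` region ws|P. x)"
    unfolding centroid_def region_def[symmetric] region_append ..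
  also have "\<dots> = word_map \<sigma> 0 + (4 / 9) ^ length \<sigma> * centroid P ws"
    unfolding measure_cylinder[OF region_subset_unit region_borel]
      moment_cylinder[OF region_subset_unit region_borel] centroid_def region_def[symmetric]
    using assms by (simp add: field_simps)
  also have "\<dots> = word_map \<sigma> (centroid P ws)" by (rule word_map_affine[symmetric])
  finally show ?thesis .
qed

lemma AE_first_generation: "AE x in P. x \<in> J [1] \<union> J [2]"
proof -
  have "J [1] \<inter> J [2] = {}" by (auto simp: J_eq similitude_def)
  then have "measure P (J [1] \<union> J [2]) = measure P (J [1]) + measure P (J [2])"
    by (intro finite_measure_Union) auto
  also have "\<dots> = 1" by (simp add: measure_J)
  finally show ?thesis by (rule AE_prob_1)
qed

text \<open>Almost every point stays in the construction of the Cantor set for ever: the part of \<open>J \<sigma>\<close> outside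
its two children is a copy of the null set \<open>[0,1] - (J [1] \<union> J [2])\<close>. As there are only countably many
words, one null set serves them all.\<close>

lemma AE_children: "AE x in P. \<forall>\<sigma>. x \<in> J \<sigma> \<longrightarrow> x \<in> J (\<sigma> @ [1]) \<or> x \<in> J (\<sigma> @ [2])"
  unfolding AE_all_countable
proof
  fix \<sigma>
  define G where "G = {0..1} - (J [1] \<union> J [2])"
  have G: "G \<subseteq> {0..1}" "G \<in> sets borel" unfolding G_def by auto
  have "measure P G = 0"
    using AE_first_generation G(2)
    by (intro measure_eq_0_null_sets AE_iff_null_sets[THEN iffD2]) (auto simp: G_def)
  then have "measure P (word_map \<sigma> ` G) = 0" using measure_cylinder[OF G] by simp
  then have "AE x in P. x \<notin> word_map \<sigma> ` G"
    using word_map_measurable_image[OF G(2)]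
    by (intro AE_not_in) (simp add: null_sets_def emeasure_eq_measure)
  then show "AE x in P. x \<in> J \<sigma> \<longrightarrow> x \<in> J (\<sigma> @ [1]) \<or> x \<in> J (\<sigma> @ [2])"
    by (rule AE_mp) (auto simp: G_def J_append J_def[of \<sigma>])
qed

text \<open>Summing the contributions of the two halves, the mean \<open>m\<close> of \<open>P\<close> solves \<open>m = 4/9 * m + 5/18\<close>.\<close>

lemma moment_unit: "(LINT x:{0..1}|P. x) = 1 / 2"
proof -
  have "(LINT x:{0..1}|P. x) = (LINT x:J [1] \<union> J [2]|P. x)"
  proof (rule set_integral_cong_set)
    show "AE x in P. x \<in> J [1] \<union> J [2] \<longleftrightarrow> x \<in> {0..1}"
      using AE_first_generation AE_unit by (auto intro: AE_mp)
  qed (auto simp: set_borel_measurable_def)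
  also have "\<dots> = (LINT x:J [1]|P. x) + (LINT x:J [2]|P. x)"
  proof (rule set_integral_Un)
    show "J [1] \<inter> J [2] = {}" by (auto simp: J_eq similitude_def)
  qed (auto intro!: set_integrable_bounded J_subset_unit)
  also have "\<dots> = 4 / 9 * (LINT x:{0..1}|P. x) + 5 / 18"
    unfolding J_def
    using moment_cylinder[of "{0..1}" "[1]"] moment_cylinder[of "{0..1}" "[2]"]
    by (simp add: measure_unit similitude_def algebra_simps)
  finally show ?thesis by simp
qed

lemma moment_J: "(LINT x:J \<sigma>|P. x) = (1 / 2) ^ length \<sigma> * (word_map \<sigma> (1 / 2))"
  using moment_cylinder[of "{0..1}" \<sigma>] word_map_affine[of \<sigma> "1 / 2"]
  by (simp add: J_def measure_unit moment_unit)

lemma region_union_step: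
  assumes "J \<beta> \<inter> region ws = {}"
  shows "measure P (region (\<beta> # ws)) = (1 / 2) ^ length \<beta> + measure P (region ws)"
    and "(LINT x:region (\<beta> # ws)|P. x)
       = (1 / 2) ^ length \<beta> * word_map \<beta> (1 / 2) + (LINT x:region ws|P. x)"
proof -
  show "measure P (region (\<beta> # ws)) = (1 / 2) ^ length \<beta> + measure P (region ws)"
    using assms finite_measure_Union[of "J \<beta>" "region ws"] by (simp add: measure_J)
  show "(LINT x:region (\<beta> # ws)|P. x)
      = (1 / 2) ^ length \<beta> * word_map \<beta> (1 / 2) + (LINT x:region ws|P. x)"
    using set_integral_Un[OF assms, of P "\<lambda>x. x"]
    by (simp add: moment_J set_integrable_bounded J_subset_unit region_subset_unit)
qed

lemma region_singleton:
  shows "measure P (region [\<beta>]) = (1 / 2) ^ length \<beta>"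
    and "(LINT x:region [\<beta>]|P. x) = (1 / 2) ^ length \<beta> * word_map \<beta> (1 / 2)"
  by (simp_all add: measure_J moment_J del: One_nat_def)

end

section \<open>Voronoi regions\<close>

lemma voronoi_eq_Inter:
  assumes "finite \<alpha>" "a \<in> \<alpha>"
  shows "voronoi a \<alpha> = (\<Inter>b\<in>\<alpha>. {x. \<bar>x - a\<bar> \<le> \<bar>x - b\<bar>})"
proof -
  have "\<bar>x - a\<bar> = Min ((\<lambda>b. \<bar>x - b\<bar>) ` \<alpha>) \<longleftrightarrow> (\<forall>b\<in>\<alpha>. \<bar>x - a\<bar> \<le> \<bar>x - b\<bar>)" for x
    using assms by (subst eq_Min_iff) auto
  then show ?thesis by (auto simp: voronoi_def)
qed

lemma voronoi_borel:
  assumes "finite \<alpha>" "a \<in> \<alpha>"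
  shows "voronoi a \<alpha> \<in> sets borel"
  unfolding voronoi_eq_Inter[OF assms]
  by (intro borel_closed closed_INT ballI closed_Collect_le continuous_intros)

context cantor_measure
begin

text \<open>The criterion for a CVT used here: if almost all of the mass lies in regions \<open>R i\<close>, each with
centroid \<open>c i\<close>, and every point of \<open>R i\<close> is strictly nearer to \<open>c i\<close> than to all the other centres, then the
Voronoi region of \<open>c i\<close> agrees with \<open>R i\<close> up to a null set. The strict inequality also makes \<open>c\<close> injective,
which fixes the number of centres.\<close>

lemma CVT_of_nearest_regions:
  fixes c :: "'i \<Rightarrow> real" and R :: "'i \<Rightarrow> real set"
  assumes fin: "finite K"
    and borel: "\<And>i. i \<in> K \<Longrightarrow> R i \<in> sets borel"
    and pos: "\<And>i. i \<in> K \<Longrightarrow> measure P (R i) > 0"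
    and mean: "\<And>i. i \<in> K \<Longrightarrow> c i = 1 / measure P (R i) * (LINT x:R i|P. x)"
    and cover: "AE x in P. \<exists>i\<in>K. x \<in> R i"
    and nearest: "\<And>i j x. \<lbrakk>i \<in> K; j \<in> K; i \<noteq> j; x \<in> R i\<rbrakk> \<Longrightarrow> \<bar>x - c i\<bar> < \<bar>x - c j\<bar>"
  shows "CVT P (card K) (c ` K)"
proof -
  have inj: "inj_on c K"
  proof (rule inj_onI, rule ccontr)
    fix i j assume ij: "i \<in> K" "j \<in> K" "c i = c j" "i \<noteq> j"
    obtain x where "x \<in> R i" using pos[OF ij(1)] by force
    with nearest[of i j x] ij show False by simp
  qed
  have "measure P (voronoi (c i) (c ` K)) > 0 \<and>
      c i = 1 / measure P (voronoi (c i) (c ` K)) * (LINT x:voronoi (c i) (c ` K)|P. x)"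
    if i: "i \<in> K" for i
  proof -
    let ?V = "voronoi (c i) (c ` K)"
    have V: "?V = (\<Inter>j\<in>K. {x. \<bar>x - c i\<bar> \<le> \<bar>x - c j\<bar>})"
      using voronoi_eq_Inter[of "c ` K" "c i"] fin i by simp
    have [measurable]: "?V \<in> sets borel" "R i \<in> sets borel"
      using voronoi_borel[of "c ` K" "c i"] fin i borel by auto
    have same: "AE x in P. x \<in> ?V \<longleftrightarrow> x \<in> R i"
      using cover
    proof (rule AE_mp, intro AE_I2 impI)
      fix x assume "\<exists>j\<in>K. x \<in> R j"
      then obtain j where j: "j \<in> K" "x \<in> R j" by blast
      show "x \<in> ?V \<longleftrightarrow> x \<in> R i"
      proof
        assume "x \<in> ?V"
        then have "\<bar>x - c i\<bar> \<le> \<bar>x - c j\<bar>" using j unfolding V by blast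
        with nearest[of j i x] i j show "x \<in> R i" by (cases "i = j") auto
      next
        assume "x \<in> R i"
        then have "\<bar>x - c i\<bar> \<le> \<bar>x - c m\<bar>" if "m \<in> K" for m
          using nearest[of i m x] i that by (cases "i = m") auto
        then show "x \<in> ?V" unfolding V by blast
      qed
    qed
    have "measure P ?V = measure P (R i)"
      using same by (rule finite_measure_eq_AE) auto
    moreover have "(LINT x:?V|P. x) = (LINT x:R i|P. x)"
      using same by (intro set_integral_cong_set) (auto simp: set_borel_measurable_def)
    ultimately show ?thesis using pos[OF i] mean[OF i] by simp
  qed
  then show ?thesis
    using fin inj by (auto simp: CVT_def card_image)
qed

end

section \<open>Three tilings of the unit interval\<close>

text \<open>A cell is a list of words, standing for the union of their cylinders; a tiling is a set of cells
that splits the Cantor set. The halves give the two centres of a word outside \<open>I\<close>, the triples the two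
possible values of \<open>A \<sigma>\<close>; the second triple is the mirror image of the first under \<open>x \<mapsto> 1 - x\<close>.\<close>

definition halves :: "nat list list set" where
  "halves = {[[1]], [[2]]}"

definition left_triple :: "nat list list set" where
  "left_triple = {[[1,1], [1,2,1], [1,2,2,1]], [[1,2,2,2], [2,1]], [[2,2]]}"

definition right_triple :: "nat list list set" where
  "right_triple = {[[1,1]], [[1,2], [2,1,1,1]], [[2,1,1,2], [2,1,2], [2,2]]}"

definition tilings :: "nat list list set set" where
  "tilings = {halves, left_triple, right_triple}"

lemma finite_tiling: "T \<in> tilings \<Longrightarrow> finite T"
  unfolding tilings_def halves_def left_triple_def right_triple_def
  by (elim insertE emptyE) simp_all

text \<open>These hulls are all that the comparison of distances needs of the cells: the midpoint
between the centroids of neighbouring cells falls into the gap between their hulls.\<close>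

lemma region_hulls:
  "region [[1]] \<subseteq> {0..4 / 9}"
  "region [[2]] \<subseteq> {5 / 9..1}"
  "region [[1,1], [1,2,1], [1,2,2,1]] \<subseteq> {0..2596 / 6561}"
  "region [[1,2,2,2], [2,1]] \<subseteq> {2660 / 6561..61 / 81}"
  "region [[2,2]] \<subseteq> {65 / 81..1}"
  "region [[1,1]] \<subseteq> {0..16 / 81}"
  "region [[1,2], [2,1,1,1]] \<subseteq> {20 / 81..3901 / 6561}"
  "region [[2,1,1,2], [2,1,2], [2,2]] \<subseteq> {3965 / 6561..1}"
  by (auto simp: J_eq similitude_def power_divide)

lemma tiling_covers:
  assumes "T \<in> tilings" "x \<in> J \<sigma>" "\<And>\<rho>. x \<in> J \<rho> \<Longrightarrow> x \<in> J (\<rho> @ [1]) \<or> x \<in> J (\<rho> @ [2])"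
  shows "\<exists>ws\<in>T. x \<in> word_map \<sigma> ` region ws"
proof -
  have split: "x \<in> J (\<sigma> @ \<rho>) \<Longrightarrow> x \<in> J (\<sigma> @ \<rho> @ [1]) \<or> x \<in> J (\<sigma> @ \<rho> @ [2])" for \<rho>
    using assms(3)[of "\<sigma> @ \<rho>"] by simp
  have "x \<in> J (\<sigma> @ [1]) \<or> x \<in> J (\<sigma> @ [2])"
    using assms(2,3) by blast
  then show ?thesis
    using assms(1) split[of "[1]"] split[of "[2]"] split[of "[1,2]"] split[of "[2,1]"]
      split[of "[1,2,2]"] split[of "[2,1,1]"]
    unfolding tilings_def halves_def left_triple_def right_triple_def
    by (auto simp flip: region_append)
qed

context cantor_measure
begin

lemma tiling_mass_pos:
  assumes "T \<in> tilings" "ws \<in> T"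
  shows "measure P (region ws) > 0"
proof -
  obtain \<beta> where "\<beta> \<in> set ws"
    using assms unfolding tilings_def halves_def left_triple_def right_triple_def by force
  then have "measure P (J \<beta>) \<le> measure P (region ws)"
    by (intro finite_measure_mono) (auto simp: region_def)
  moreover have "measure P (J \<beta>) > 0" by (simp add: measure_J)
  ultimately show ?thesis by linarith
qed

text \<open>Each value is the mean of the midpoints \<open>word_map \<beta> (1/2)\<close> with weights \<open>2^(-|\<beta>|)\<close>.\<close>

lemma centroid_values:
  "centroid P [[1]] = 2 / 9"
  "centroid P [[2]] = 7 / 9"
  "centroid P [[1,1], [1,2,1], [1,2,2,1]] = 1268 / 6561"
  "centroid P [[1,2,2,2], [2,1]] = 3992 / 6561"
  "centroid P [[2,2]] = 73 / 81"
  "centroid P [[1,1]] = 8 / 81"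
  "centroid P [[1,2], [2,1,1,1]] = 2569 / 6561"
  "centroid P [[2,1,1,2], [2,1,2], [2,2]] = 5293 / 6561"
proof -
  have quot: "centroid P ws = (LINT x:region ws|P. x) / measure P (region ws)" for ws
    by (simp add: centroid_def region_def)
  note eval = J_eq similitude_def power_divide
  show "centroid P [[1]] = 2 / 9" "centroid P [[2]] = 7 / 9"
      "centroid P [[2,2]] = 73 / 81" "centroid P [[1,1]] = 8 / 81"
    by (simp_all add: quot region_singleton eval del: region_Cons)
  have "J [1,1] \<inter> region [[1,2,1], [1,2,2,1]] = {}" "J [1,2,1] \<inter> region [[1,2,2,1]] = {}"
      "J [1,2,2,2] \<inter> region [[2,1]] = {}" "J [1,2] \<inter> region [[2,1,1,1]] = {}"
      "J [2,1,1,2] \<inter> region [[2,1,2], [2,2]] = {}" "J [2,1,2] \<inter> region [[2,2]] = {}"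
    by (auto simp: eval)
  note disjoint = this[THEN region_union_step(1)] this[THEN region_union_step(2)]
  show "centroid P [[1,1], [1,2,1], [1,2,2,1]] = 1268 / 6561"
      "centroid P [[1,2,2,2], [2,1]] = 3992 / 6561"
      "centroid P [[1,2], [2,1,1,1]] = 2569 / 6561"
      "centroid P [[2,1,1,2], [2,1,2], [2,2]] = 5293 / 6561"
    unfolding quot disjoint region_singleton by (simp_all add: similitude_def power_divide)
qed

lemma tiling_nearest:
  assumes "T \<in> tilings" "ws \<in> T" "ws' \<in> T" "ws \<noteq> ws'" "y \<in> region ws"
  shows "\<bar>y - centroid P ws\<bar> < \<bar>y - centroid P ws'\<bar>"
  using assms unfolding tilings_def halves_def left_triple_def right_triple_def
  by (auto simp: centroid_values[unfolded One_nat_def] abs_if simp del: region_Cons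
      dest!: region_hulls[unfolded One_nat_def, THEN subsetD])

text \<open>Reflecting a centroid in a point \<open>y\<close> of its own cell gives \<open>2 * y - centroid P ws\<close>, the far end of the
interval of points that are at most as far from \<open>y\<close> as the centroid is. It leaves \<open>[0,1]\<close> by at most \<open>2/9\<close>;
the worst case is the outer endpoint of one of the halves.\<close>

lemma tiling_overhang:
  assumes "T \<in> tilings" "ws \<in> T" "y \<in> region ws"
  shows "2 * y - centroid P ws \<le> 11 / 9" "- (2 / 9) \<le> 2 * y - centroid P ws"
  using assms unfolding tilings_def halves_def left_triple_def right_triple_def
  by (auto simp: centroid_values[unfolded One_nat_def] simp del: region_Cons
      dest!: region_hulls[unfolded One_nat_def, THEN subsetD])

lemma tiling_centroid_bounds:
  assumes "T \<in> tilings" "ws \<in> T"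
  shows "8 / 81 \<le> centroid P ws" "centroid P ws \<le> 73 / 81"
  using assms unfolding tilings_def halves_def left_triple_def right_triple_def
  by (auto simp: centroid_values[unfolded One_nat_def])

section \<open>Tilings of all blocks\<close>

text \<open>A centre in another block \<open>J \<tau>\<close> never competes, whichever tilings the two blocks carry. In units of
the length \<open>s\<close> of a block, the reflection of a centroid in a point of its cell leaves \<open>J \<sigma>\<close> by at
most \<open>2/9\<close>, the foreign centre is at least \<open>8/81\<close> inside \<open>J \<tau>\<close>, and the gap between the blocks is at least \<open>1/4\<close>, which
exceeds the difference \<open>2/9 - 8/81 = 10/81\<close>.\<close>

lemma blocks_nearest:
  assumes T: "T \<in> tilings" "T' \<in> tilings" and ws: "ws \<in> T" "ws' \<in> T'"
    and words: "\<sigma> \<in> words m" "\<tau> \<in> words m" "\<sigma> \<noteq> \<tau>" and y: "y \<in> region ws"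
  shows "\<bar>word_map \<sigma> y - word_map \<sigma> (centroid P ws)\<bar>
       < \<bar>word_map \<sigma> y - word_map \<tau> (centroid P ws')\<bar>"
proof -
  define s c c' where "s = (4 / 9 :: real) ^ m" "c = centroid P ws" "c' = centroid P ws'"
  have s: "s > 0" unfolding s_c_c'_def by simp
  have len: "length \<sigma> = m" "length \<tau> = m" using words by (auto simp: words_def)
  note overhang = tiling_overhang[OF T(1) ws(1) y, folded s_c_c'_def(2)]
  note c = tiling_centroid_bounds[OF T(1) ws(1), folded s_c_c'_def(2)]
  note c' = tiling_centroid_bounds[OF T(2) ws(2), folded s_c_c'_def(3)]
  have less: "s * u < s * (5 / 4)" if "u < 5 / 4" for u
    using s that by simp
  have "s * (2 * y - c - c') < s * (5 / 4)" "s * (c' + c - 2 * y) < s * (5 / 4)"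
      "s * (c - c') < s * (5 / 4)" "s * (c' - c) < s * (5 / 4)"
    by (rule less, use overhang c c' in linarith)+
  then show ?thesis
    using word_map_separated[OF words] unfolding s_c_c'_def(2,3)[symmetric]
    unfolding word_map_affine[of \<sigma> y] word_map_affine[of \<sigma> c] word_map_affine[of \<tau> c'] len
      s_c_c'_def(1)[symmetric]
    by (auto simp: algebra_simps abs_if)
qed

definition centres :: "nat list \<Rightarrow> nat list list set \<Rightarrow> real set" where
  "centres \<sigma> T = (\<lambda>ws. word_map \<sigma> (centroid P ws)) ` T"

lemma CVT_of_tilings:
  assumes T: "\<And>\<sigma>. \<sigma> \<in> words m \<Longrightarrow> T \<sigma> \<in> tilings"
  shows "CVT P (\<Sum>\<sigma>\<in>words m. card (T \<sigma>)) (\<Union>\<sigma>\<in>words m. centres \<sigma> (T \<sigma>))"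
proof -
  define K where "K = Sigma (words m) T"
  define c where "c = (\<lambda>(\<sigma>, ws). word_map \<sigma> (centroid P ws))"
  define R where "R = (\<lambda>(\<sigma>, ws). word_map \<sigma> ` region ws)"
  have finT: "finite (T \<sigma>)" if "\<sigma> \<in> words m" for \<sigma>
    using T[OF that] by (rule finite_tiling)
  have "CVT P (card K) (c ` K)"
  proof (rule CVT_of_nearest_regions[where R = R])
    show "finite K" unfolding K_def by (rule finite_SigmaI[OF finite_words finT])
  next
    fix i assume "i \<in> K"
    then obtain \<sigma> ws where i: "i = (\<sigma>, ws)" "\<sigma> \<in> words m" "ws \<in> T \<sigma>" by (auto simp: K_def)
    note pos = tiling_mass_pos[OF T[OF i(2)] i(3)]
    show "R i \<in> sets borel"
      unfolding R_def i by (simp add: word_map_measurable_image)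
    show "measure P (R i) > 0"
      unfolding R_def i using pos by (simp add: measure_cylinder region_subset_unit)
    show "c i = 1 / measure P (R i) * (LINT x:R i|P. x)"
      unfolding c_def R_def i prod.case centroid_append[OF pos, symmetric]
      by (simp only: centroid_def region_def[symmetric] region_append)
  next
    show "AE x in P. \<exists>i\<in>K. x \<in> R i"
      using AE_children AE_unit
    proof eventually_elim
      case (elim x)
      have "\<exists>\<sigma>\<in>words q. x \<in> J \<sigma>" for q
      proof (induction q)
        case 0
        then show ?case using elim by (simp add: words_def J_def)
      next
        case (Suc q)
        then obtain \<sigma> where \<sigma>: "\<sigma> \<in> words q" "x \<in> J \<sigma>" by blast
        then have "\<sigma> @ [1] \<in> words (Suc q)" "\<sigma> @ [2] \<in> words (Suc q)" by (auto simp: words_def)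
        with \<sigma> elim show ?case by blast
      qed
      then obtain \<sigma> where \<sigma>: "\<sigma> \<in> words m" "x \<in> J \<sigma>" by blast
      then obtain ws where "ws \<in> T \<sigma>" "x \<in> word_map \<sigma> ` region ws"
        using tiling_covers[OF T[OF \<sigma>(1)] \<sigma>(2)] elim by blast
      with \<sigma> show ?case by (auto simp: K_def R_def intro!: bexI[of _ "(\<sigma>, ws)"])
    qed
  next
    fix i j x assume ij: "i \<in> K" "j \<in> K" "i \<noteq> j" "x \<in> R i"
    obtain \<sigma> ws where i: "i = (\<sigma>, ws)" "\<sigma> \<in> words m" "ws \<in> T \<sigma>"
      using ij(1) by (auto simp: K_def)
    obtain \<tau> ws' where j: "j = (\<tau>, ws')" "\<tau> \<in> words m" "ws' \<in> T \<tau>"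
      using ij(2) by (auto simp: K_def)
    obtain y where y: "x = word_map \<sigma> y" "y \<in> region ws"
      using ij(4) by (auto simp: R_def i)
    show "\<bar>x - c i\<bar> < \<bar>x - c j\<bar>"
    proof (cases "\<sigma> = \<tau>")
      case False
      then show ?thesis
        using blocks_nearest[OF T[OF i(2)] T[OF j(2)] i(3) j(3) i(2) j(2) _ y(2)]
        by (simp add: c_def i j y)
    next
      case True
      then have "\<bar>y - centroid P ws\<bar> < \<bar>y - centroid P ws'\<bar>"
        using tiling_nearest[OF T[OF i(2)] i(3) _ _ y(2), of ws'] ij(3) i j by simp
      moreover have "\<bar>word_map \<sigma> y - word_map \<sigma> z\<bar> = (4 / 9) ^ length \<sigma> * \<bar>y - z\<bar>" for z
        unfolding word_map_affine[of \<sigma> y] word_map_affine[of \<sigma> z]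
        by (simp add: abs_mult flip: right_diff_distrib)
      ultimately show ?thesis by (simp add: c_def i j y True)
    qed
  qed
  moreover have "card K = (\<Sum>\<sigma>\<in>words m. card (T \<sigma>))"
    unfolding K_def using finite_words finT by (simp add: card_SigmaI)
  moreover have "c ` K = (\<Union>\<sigma>\<in>words m. centres \<sigma> (T \<sigma>))"
    unfolding K_def c_def centres_def by force
  ultimately show ?thesis by simp
qed

lemma centres_halves:
  "centres \<sigma> halves = {word_map (\<sigma> @ [1]) (1 / 2), word_map (\<sigma> @ [2]) (1 / 2)}"
  unfolding centres_def halves_def
  by (simp add: centroid_values[unfolded One_nat_def] word_map_append similitude_def)

lemma centres_eq_centroids:
  assumes "T \<in> tilings"
  shows "centres \<sigma> T = (\<lambda>ws. centroid P (map ((@) \<sigma>) ws)) ` T"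
  unfolding centres_def
  by (rule image_cong[OF refl], rule centroid_append[symmetric], rule tiling_mass_pos[OF assms])

lemma centres_left_triple: "centres \<sigma> left_triple = triple1 P \<sigma>"
  by (subst centres_eq_centroids)
    (simp_all add: triple1_def tilings_def left_triple_def del: One_nat_def)

lemma centres_right_triple: "centres \<sigma> right_triple = triple2 P \<sigma>"
  by (subst centres_eq_centroids)
    (simp_all add: triple2_def tilings_def right_triple_def del: One_nat_def)

end

section \<open>Counting\<close>

text \<open>The data of a CVT of the family: \<open>I\<close> is the set of words that are split into three, and \<open>L\<close> is the part of
\<open>I\<close> where the first of the two triples is taken.\<close>

definition layout :: "nat list set \<Rightarrow> nat list set \<Rightarrow> nat list \<Rightarrow> nat list list set" where
  "layout I L \<sigma> = (if \<sigma> \<in> I then if \<sigma> \<in> L then left_triple else right_triple else halves)"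

lemma layout_tilings: "layout I L \<sigma> \<in> tilings"
  by (simp add: layout_def tilings_def)

lemma card_layout: "card (layout I L \<sigma>) = (if \<sigma> \<in> I then 3 else 2)"
  by (simp add: layout_def halves_def left_triple_def right_triple_def)

context cantor_measure
begin

definition centre_set :: "nat \<Rightarrow> nat list set \<Rightarrow> nat list set \<Rightarrow> real set" where
  "centre_set m I L = (\<Union>\<sigma>\<in>words m. centres \<sigma> (layout I L \<sigma>))"

text \<open>As the blocks are disjoint, the centres in \<open>J \<sigma>\<close> are those of the tiling of this block alone.\<close>

lemma mem_centre_set_iff:
  assumes "\<sigma> \<in> words m" "p \<in> {0..1}"
  shows "word_map \<sigma> p \<in> centre_set m I L \<longleftrightarrow> p \<in> centroid P ` layout I L \<sigma>"
proof
  assume "word_map \<sigma> p \<in> centre_set m I L"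
  then obtain \<tau> ws where \<tau>: "\<tau> \<in> words m" "ws \<in> layout I L \<tau>"
    "word_map \<sigma> p = word_map \<tau> (centroid P ws)"
    by (auto simp: centre_set_def centres_def)
  moreover have "centroid P ws \<in> {0..1}"
    using tiling_centroid_bounds[OF layout_tilings \<tau>(2)] by auto
  ultimately have "\<sigma> = \<tau>" using same_length_J_disjoint assms by blast
  with \<tau> show "p \<in> centroid P ` layout I L \<sigma>" using inj_word_map by (auto dest: injD)
qed (use assms in \<open>auto simp: centre_set_def centres_def\<close>)

text \<open>The point \<open>2/9\<close> is a centroid of the halves and of neither triple, and \<open>1268/6561\<close> is a centroid of
the first triple only; so the tiling of each block can be read off from the set of centres.\<close>

lemma centre_set_determines_layout:
  assumes "\<sigma> \<in> words m"
  shows "\<sigma> \<in> I \<longleftrightarrow> word_map \<sigma> (2 / 9) \<notin> centre_set m I L"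
    and "\<sigma> \<in> I \<inter> L \<longleftrightarrow> word_map \<sigma> (1268 / 6561) \<in> centre_set m I L"
  by (auto simp: mem_centre_set_iff[OF assms] layout_def halves_def left_triple_def
      right_triple_def centroid_values[unfolded One_nat_def])

lemma inj_on_centre_set:
  "inj_on (\<lambda>(I, L). centre_set m I L) (SIGMA I:{I. I \<subseteq> words m \<and> card I = k}. Pow I)"
proof (rule inj_onI, clarsimp)
  fix I L I' L'
  assume sub: "I \<subseteq> words m" "L \<subseteq> I" "I' \<subseteq> words m" "L' \<subseteq> I'"
    and eq: "centre_set m I L = centre_set m I' L'"
  have "\<sigma> \<in> I \<longleftrightarrow> \<sigma> \<in> I'" "\<sigma> \<in> I \<inter> L \<longleftrightarrow> \<sigma> \<in> I' \<inter> L'" if "\<sigma> \<in> words m" for \<sigma>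
    using centre_set_determines_layout[OF that, of I L]
      centre_set_determines_layout[OF that, of I' L'] eq by blast+
  with sub show "I = I' \<and> L = L'" by blast
qed

text \<open>The three cases in the definition of \<open>alpha\<close> are one: when \<open>k = 2^(l-1)\<close>, all words of length
\<open>l - 1\<close> are in \<open>I\<close> and no halves remain; when moreover \<open>k = 1\<close>, the only word is the empty one.\<close>

lemma alpha_eq_centre_set:
  assumes "k \<le> 2 ^ (l - 1)" "I \<subseteq> words (l - 1)" "card I = k"
    and A: "\<And>\<sigma>. \<sigma> \<in> I \<Longrightarrow> A \<sigma> = (if \<sigma> \<in> L then triple1 P \<sigma> else triple2 P \<sigma>)"
  shows "alpha l k I A = centre_set (l - 1) I L"
proof -
  have chosen: "A \<sigma> = centres \<sigma> (layout I L \<sigma>)" if "\<sigma> \<in> I" for \<sigma>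
    using A[OF that] that by (simp add: layout_def centres_left_triple centres_right_triple)
  have rest: "{word_map (\<sigma> @ [1]) (1 / 2), word_map (\<sigma> @ [2]) (1 / 2)} = centres \<sigma> (layout I L \<sigma>)"
    if "\<sigma> \<notin> I" for \<sigma>
    using that by (simp only: layout_def centres_halves if_False)
  show ?thesis
  proof (cases "k < 2 ^ (l - 1)")
    case True
    have "centre_set (l - 1) I L = (\<Union>\<sigma>\<in>I. centres \<sigma> (layout I L \<sigma>))
        \<union> (\<Union>\<sigma>\<in>words (l - 1) - I. centres \<sigma> (layout I L \<sigma>))"
      unfolding centre_set_def using assms(2) by blast
    also have "\<dots> = alpha l k I A"
      unfolding alpha_def if_P[OF True]
      by (intro arg_cong2[where f = "(\<union>)"] SUP_cong refl chosen[symmetric] rest[symmetric]) auto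
    finally show ?thesis by (rule sym)
  next
    case False
    then have full: "k = 2 ^ (l - 1)" using assms(1) by simp
    then have I: "I = words (l - 1)"
      using assms(2,3) card_subset_eq[OF finite_words] by (simp add: card_words)
    have "alpha l k I A = (\<Union>\<sigma>\<in>I. A \<sigma>)"
    proof (cases "k = 1")
      case True
      then have "words (l - 1) = {[]}" using full by (cases "l - 1") (auto simp: words_def)
      with True False I show ?thesis by (simp add: alpha_def)
    qed (use False in \<open>simp add: alpha_def\<close>)
    then show ?thesis using I chosen by (simp add: centre_set_def)
  qed
qed

lemma CVT_centre_set:
  assumes "I \<subseteq> words m"
  shows "CVT P (2 ^ Suc m + card I) (centre_set m I L)"
proof -
  have "(\<Sum>\<sigma>\<in>words m. card (layout I L \<sigma>)) = (\<Sum>\<sigma>\<in>words m. 2 + (if \<sigma> \<in> I then 1 else 0))"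
    by (rule sum.cong) (auto simp: card_layout)
  also have "\<dots> = 2 ^ Suc m + card I"
    unfolding sum.distrib using assms finite_words[of m]
    by (simp add: card_words sum.If_cases Int_absorb1)
  finally show ?thesis
    using CVT_of_tilings[of m "layout I L", OF layout_tilings] by (simp add: centre_set_def)
qed

lemma alpha_family_eq:
  assumes "k \<le> 2 ^ (l - 1)"
  shows "{alpha l k I A |I A. I \<subseteq> words (l - 1) \<and> card I = k \<and> admissible P A}
       = (\<lambda>(I, L). centre_set (l - 1) I L) ` (SIGMA I:{I. I \<subseteq> words (l - 1) \<and> card I = k}. Pow I)"
    (is "?lhs = ?rhs")
proof
  show "?lhs \<subseteq> ?rhs"
  proof clarify
    fix I A assume I: "I \<subseteq> words (l - 1)" "k = card I" and A: "admissible P A"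
    define L where "L = {\<sigma> \<in> I. A \<sigma> = triple1 P \<sigma>}"
    have "alpha l k I A = centre_set (l - 1) I L"
      using assms I A by (intro alpha_eq_centre_set) (auto simp: L_def admissible_def)
    then show "alpha l (card I) I A \<in> (\<lambda>(I, L). centre_set (l - 1) I L) `
        (SIGMA Ia:{Ia. Ia \<subseteq> words (l - 1) \<and> card Ia = card I}. Pow Ia)"
      using I by (auto simp: L_def intro!: image_eqI[of _ _ "(I, L)"])
  qed
next
  show "?rhs \<subseteq> ?lhs"
  proof clarify
    fix I L assume I: "I \<subseteq> words (l - 1)" "k = card I" and L: "L \<subseteq> I"
    define A where "A \<sigma> = (if \<sigma> \<in> L then triple1 P \<sigma> else triple2 P \<sigma>)" for \<sigma>
    have "admissible P A" by (simp add: A_def admissible_def)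
    moreover have "alpha l k I A = centre_set (l - 1) I L"
      using assms I by (intro alpha_eq_centre_set) (auto simp: A_def)
    ultimately show "\<exists>Ia A. centre_set (l - 1) I L = alpha l (card I) Ia A \<and>
        Ia \<subseteq> words (l - 1) \<and> card Ia = card I \<and> admissible P A"
      using I by metis
  qed
qed

lemma card_alpha_family:
  assumes "k \<le> 2 ^ (l - 1)"
  shows "card {alpha l k I A |I A. I \<subseteq> words (l - 1) \<and> card I = k \<and> admissible P A}
       = 2 ^ k * (2 ^ (l - 1) choose k)"
proof -
  let ?F = "{I. I \<subseteq> words (l - 1) \<and> card I = k}"
  have fin: "finite ?F" "\<And>I. I \<in> ?F \<Longrightarrow> finite I"
    using finite_words finite_subset by (auto intro: finite_subset[of _ "Pow (words (l - 1))"])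
  have "card (SIGMA I:?F. Pow I) = (\<Sum>I\<in>?F. card (Pow I))"
    by (rule card_SigmaI[OF fin(1)], rule ballI, rule finite_Pow_iff[THEN iffD2], rule fin(2))
  also have "\<dots> = (\<Sum>I\<in>?F. 2 ^ k)"
  proof (rule sum.cong)
    fix I assume "I \<in> ?F"
    then show "card (Pow I) = 2 ^ k" using card_Pow[OF fin(2)] by simp
  qed simp
  also have "\<dots> = 2 ^ k * (2 ^ (l - 1) choose k)"
    using n_subsets[OF finite_words, of "l - 1" k] by (simp add: card_words)
  finally show ?thesis
    unfolding alpha_family_eq[OF assms] by (subst card_image[OF inj_on_centre_set])
qed

end

theorem proposition3p11:
  fixes P :: "real measure" and n l k :: nat
  assumes "self_similar P"
    and "n = 2 ^ l + k"
    and "l \<ge> 1"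
    and "1 \<le> k" and "k \<le> 2 ^ (l - 1)"
  shows "(\<forall>I A. I \<subseteq> words (l - 1) \<and> card I = k \<and> admissible P A \<longrightarrow> CVT P n (alpha l k I A)) \<and>
    (k < 2 ^ (l - 1) \<longrightarrow>
      card {alpha l k I A |I A. I \<subseteq> words (l - 1) \<and> card I = k \<and> admissible P A}
        = 2 ^ (n - 2 ^ l) * ((2 ^ (l - 1)) choose (n - 2 ^ l))) \<and>
    (k = 2 ^ (l - 1) \<longrightarrow>
      card {alpha l k I A |I A. I \<subseteq> words (l - 1) \<and> card I = k \<and> admissible P A}
        = 2 ^ (2 ^ (l - 1)))"
proof -
  interpret cantor_measure P by unfold_locales (rule assms(1))
  have "CVT P n (alpha l k I A)"
    if I: "I \<subseteq> words (l - 1)" "card I = k" and A: "admissible P A" for I A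
  proof -
    have "alpha l k I A \<in> (\<lambda>(I, L). centre_set (l - 1) I L) `
        (SIGMA I:{I. I \<subseteq> words (l - 1) \<and> card I = k}. Pow I)"
      unfolding alpha_family_eq[OF assms(5), symmetric] using that by blast
    then show ?thesis
      using CVT_centre_set[of _ "l - 1"] assms(2,3) by auto
  qed
  moreover have "card {alpha l k I A |I A. I \<subseteq> words (l - 1) \<and> card I = k \<and> admissible P A}
      = 2 ^ (2 ^ (l - 1))" if "k = 2 ^ (l - 1)"
    unfolding card_alpha_family[OF assms(5)] using that by simp
  ultimately show ?thesis
    using card_alpha_family[OF assms(5)] assms(2) by (intro conjI impI allI) simp_all
qed

end
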